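(* Let $\mu$ and $\lambda$ be cardinals with $\omega < \mu \leq \lambda$. Then the following hold. (1) If $[\mu,\lambda]$-compactness is productive for members of the class $\mathcal{C}_\mu$, then $\mu$ is a $\lambda$-compact cardinal. In particular, if $[\mu,\lambda]$-compactness is productive, then $\mu$ is a $\lambda$-compact cardinal. (2) If $\mu$ is $\lambda$-compact, and $\lambda$ is a strong limit singular cardinal of cofinality $\geq \mu$, then $[\mu,\lambda]$-compactness is productive.
   Context: For infinite cardinals $\mu$ and $\lambda$, a topological space is $[\mu,\lambda]$-compact if every open cover by at most $\lambda$ sets has a subcover by less than $\mu$ sets. $[\mu,\lambda]$-compactness is productive if every product (with the Tychonoff product topology, over an arbitrary index set) of $[\mu,\lambda]$-compact topological spaces is $[\mu,\lambda]$-compact. For a class $\mathcal{K}$ of topological spaces, $[\mu,\lambda]$-compactness is productive for members of $\mathcal{K}$ if every product $\prod_{j\in J} X_j$ of $[\mu,\lambda]$-compact topological spaces belonging to $\mathcal{K}$ is $[\mu,\lambda]$-compact (the product itself need not belong to $\mathcal{K}$). $\mathcal{C}_\mu$ is the class of all infinite regular cardinals $<\mu$, each one endowed with the order topology. An ultrafilter $D$ is $(\mu,\lambda)$-regular if there is a family of $\lambda$-many members of $D$ such that the intersection of any $\mu$-many of them is empty. An ultrafilter is $\mu$-complete if it is closed under intersections of fewer than $\mu$ of its members. A cardinal $\mu>\omega$ is $\lambda$-compact if there exists a $\mu$-complete $(\mu,\lambda)$-regular ultrafilter (over some set). *)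

theory Defs
  imports "HOL-Analysis.Analysis"
begin

unbundle cardinal_syntax

text \<open>
  Cardinals are represented, as in the library, by relations \<open>r\<close> with \<open>Card_order r\<close>, that is, by
  initial well-orders; they are compared by \<open>\<le>o\<close>, \<open><o\<close> and \<open>=o\<close>, also across different types.

  Quantification over types is not available inside a formula. Notions that quantify over all sets,
  or over all families of spaces, therefore carry type arguments saying where the index sets, the
  spaces or the underlying sets live. \<open>productive_for\<close> and \<open>productive\<close> are universal in their type
  arguments: as a premise at one particular type they are weaker than at all types together.
  \<open>compact_cardinal\<close> is existential: as a conclusion at one particular type it is stronger than
  the existence of an ultrafilter over some set.
\<close>

definition interval_compact :: "'m rel \<Rightarrow> 'l rel \<Rightarrow> 'a topology \<Rightarrow> bool" where
  "interval_compact \<mu> \<Lambda> X \<longleftrightarrow>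
     (\<forall>\<U>. (\<forall>U\<in>\<U>. openin X U) \<and> \<Union>\<U> = topspace X \<and> |\<U>| \<le>o \<Lambda> \<longrightarrow>
        (\<exists>\<V>. \<V> \<subseteq> \<U> \<and> \<Union>\<V> = topspace X \<and> |\<V>| <o \<mu>))"

definition productive_for ::
  "'i itself \<Rightarrow> 'm rel \<Rightarrow> 'l rel \<Rightarrow> 'a topology set \<Rightarrow> bool" where
  "productive_for I \<mu> \<Lambda> \<K> \<longleftrightarrow>
     (\<forall>(J :: 'i set) X. (\<forall>j\<in>J. X j \<in> \<K> \<and> interval_compact \<mu> \<Lambda> (X j)) \<longrightarrow>
        interval_compact \<mu> \<Lambda> (product_topology X J))"

definition productive :: "'i itself \<Rightarrow> 'a itself \<Rightarrow> 'm rel \<Rightarrow> 'l rel \<Rightarrow> bool" where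
  "productive I A \<mu> \<Lambda> \<longleftrightarrow> productive_for I \<mu> \<Lambda> (UNIV :: 'a topology set)"

text \<open>
  The order topology of a linear order \<open>r\<close> given as a reflexive relation. The open rays
  form a subbase; \<open>Field r\<close> is added so that it is the whole space also when there are no rays.
\<close>

definition rel_order_topology :: "'a rel \<Rightarrow> 'a topology" where
  "rel_order_topology r =
     topology_generated_by ({Field r} \<union> underS r ` Field r \<union> aboveS r ` Field r)"

text \<open>
  Every cardinal below \<open>\<mu>\<close> has a representative on the type of \<open>\<mu>\<close>. All representatives on that
  type are admitted; those of the same cardinal give homeomorphic spaces.
\<close>

definition regular_below :: "'m rel \<Rightarrow> 'm topology set" where
  "regular_below \<mu> =
     {rel_order_topology \<kappa> | \<kappa> :: 'm rel. Cinfinite \<kappa> \<and> regularCard \<kappa> \<and> \<kappa> <o \<mu>}"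

definition ultrafilter_over :: "'s set \<Rightarrow> 's set set \<Rightarrow> bool" where
  "ultrafilter_over S D \<longleftrightarrow>
     D \<subseteq> Pow S \<and> S \<in> D \<and> {} \<notin> D \<and>
     (\<forall>A\<in>D. \<forall>B\<in>D. A \<inter> B \<in> D) \<and>
     (\<forall>A\<in>D. \<forall>B. A \<subseteq> B \<and> B \<subseteq> S \<longrightarrow> B \<in> D) \<and>
     (\<forall>A. A \<subseteq> S \<longrightarrow> A \<in> D \<or> S - A \<in> D)"

definition regular_ultrafilter :: "'m rel \<Rightarrow> 'l rel \<Rightarrow> 's set set \<Rightarrow> bool" where
  "regular_ultrafilter \<mu> \<Lambda> D \<longleftrightarrow>
     (\<exists>\<F>. \<F> \<subseteq> D \<and> |\<F>| =o \<Lambda> \<and> (\<forall>\<G>. \<G> \<subseteq> \<F> \<and> |\<G>| =o \<mu> \<longrightarrow> \<Inter>\<G> = {}))"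

definition complete_ultrafilter :: "'m rel \<Rightarrow> 's set set \<Rightarrow> bool" where
  "complete_ultrafilter \<mu> D \<longleftrightarrow>
     (\<forall>\<G>. \<G> \<subseteq> D \<and> \<G> \<noteq> {} \<and> |\<G>| <o \<mu> \<longrightarrow> \<Inter>\<G> \<in> D)"

definition compact_cardinal :: "'s itself \<Rightarrow> 'm rel \<Rightarrow> 'l rel \<Rightarrow> bool" where
  "compact_cardinal T \<mu> \<Lambda> \<longleftrightarrow>
     Card_order \<mu> \<and> natLeq <o \<mu> \<and>
     (\<exists>(S :: 's set) D. ultrafilter_over S D \<and> complete_ultrafilter \<mu> D \<and> regular_ultrafilter \<mu> \<Lambda> D)"

definition cofinality :: "'a rel \<Rightarrow> 'a rel" where
  "cofinality r =
     |SOME K. K \<subseteq> Field r \<and> cofinal K r \<and> (\<forall>L. L \<subseteq> Field r \<and> cofinal L r \<longrightarrow> |K| \<le>o |L| )|"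

definition strong_limit :: "'l rel \<Rightarrow> bool" where
  "strong_limit \<Lambda> \<longleftrightarrow>
     Cinfinite \<Lambda> \<and> (\<forall>\<kappa> :: 'l rel. Card_order \<kappa> \<and> \<kappa> <o \<Lambda> \<longrightarrow> ctwo ^c \<kappa> <o \<Lambda>)"

definition singular :: "'l rel \<Rightarrow> bool" where
  "singular \<Lambda> \<longleftrightarrow> Cinfinite \<Lambda> \<and> \<not> regularCard \<Lambda>"

lemma topspace_rel_order_topology [simp]: "topspace (rel_order_topology r) = Field r"
  unfolding rel_order_topology_def topology_generated_by_topspace
  by (auto simp: underS_def aboveS_def Field_def)

lemma cofinality_attained:
  assumes "Cinfinite r"
  obtains K where "K \<subseteq> Field r" "cofinal K r" "cofinality r = |K|"
    "\<And>L. L \<subseteq> Field r \<Longrightarrow> cofinal L r \<Longrightarrow> |K| \<le>o |L|"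
proof -
  let ?R = "{|K| | K. K \<subseteq> Field r \<and> cofinal K r}"
  have "cofinal (Field r) r"
    using assms infinite_Card_order_limit unfolding cofinal_def cinfinite_def by fastforce
  hence "?R \<noteq> {}" by blast
  moreover have "\<forall>r'\<in>?R. Well_order r'" using card_of_Well_order by blast
  ultimately obtain q where "q \<in> ?R" "\<forall>q'\<in>?R. q \<le>o q'"
    using exists_minim_Well_order[of ?R] by blast
  hence "\<exists>K. K \<subseteq> Field r \<and> cofinal K r \<and> (\<forall>L. L \<subseteq> Field r \<and> cofinal L r \<longrightarrow> |K| \<le>o |L| )"
    by blast
  from someI_ex[OF this] show thesis
    using that unfolding cofinality_def by blast
qed

end

theory Submission
  imports Defs
begin

text \<open>
  Write \<open>S\<close> for the set of subsets of \<open>\<Lambda>\<close> of cardinality less than \<open>\<mu>\<close>. An ultrafilter over \<open>S\<close> is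
  fine if it contains \<open>{s. F \<subseteq> s}\<close> for all finite \<open>F \<subseteq> \<Lambda>\<close>. A fine ultrafilter is \<open>(\<mu>, \<Lambda>)\<close>-regular,
  because an \<open>s \<in> S\<close> has fewer than \<open>\<mu>\<close> elements. So \<open>\<mu>\<close> is \<open>\<Lambda>\<close>-compact once some fine ultrafilter is
  \<open>\<mu>\<close>-complete.

  For the first part, suppose that no fine ultrafilter is \<open>\<mu>\<close>-complete. A smallest family witnessing
  that \<open>D\<close> is incomplete is indexed by an infinite regular \<open>\<kappa>\<close> below \<open>\<mu>\<close>, and sending \<open>s\<close> to the index
  of a member that omits \<open>s\<close> gives a map from \<open>S\<close> to \<open>\<kappa>\<close> that takes values in no initial segment on a
  set of \<open>D\<close> (\<open>not_complete_imp_divergent\<close>); in the order topology it has no limit along \<open>D\<close>. All these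
  maps together form one map \<open>x\<close> from \<open>S\<close> to a product of spaces of cardinality below \<open>\<mu>\<close>, which are
  trivially \<open>[\<mu>, \<Lambda>]\<close>-compact. If the product is \<open>[\<mu>, \<Lambda>]\<close>-compact, then \<open>x\<close> has a limit along some fine
  ultrafilter (\<open>interval_compact_fine_limit\<close>), and the coordinate belonging to that very ultrafilter
  contradicts divergence.

  For the second part, let \<open>D\<close> be \<open>\<mu>\<close>-complete and \<open>(\<mu>, \<Lambda>)\<close>-regular. If \<open>X\<close> is \<open>[\<mu>, \<Lambda>]\<close>-compact, then every
  map into \<open>X\<close> whose range has at most \<open>\<Lambda>\<close> subsets has a limit along \<open>D\<close>
  (\<open>complete_ultrafilter_limit\<close>). This passes to products coordinatewise. Given a cover of the product
  by fewer than \<open>\<Lambda>\<close> open sets without a small subcover, regularity assigns to every index \<open>t\<close> a small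
  subfamily of the cover and hence a point \<open>x t\<close> missed by it, in such a way that no set of the cover
  contains \<open>x t\<close> for \<open>D\<close>-many \<open>t\<close>; but \<open>\<Lambda>\<close> is a strong limit, so \<open>x\<close> has a limit, a contradiction
  (\<open>product_subcover_below_strong_limit\<close>). A cover of size \<open>\<Lambda>\<close> is an increasing union of smaller families
  along a cofinal set of size \<open>cof \<Lambda>\<close>. As \<open>cof \<Lambda> < \<Lambda>\<close>, fewer than \<open>\<mu>\<close> of their unions cover the space, and
  as \<open>\<mu> \<le> cof \<Lambda>\<close>, a single one does (\<open>interval_compact_if_smaller_subcovers\<close>).
\<close>

section \<open>Cardinals\<close>

lemma infinite_Field_if_natLeq_ordLess:
  assumes "Card_order r" "natLeq <o r"
  shows "infinite (Field r)"
  using ordLeq_ordIso_trans[OF ordLess_imp_ordLeq[OF assms(2)]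
      ordIso_symmetric[OF card_of_Field_ordIso[OF assms(1)]]]
    infinite_iff_natLeq_ordLeq[of "Field r"]
  by auto

lemma card_of_Fpow_ordLeq:
  assumes "infinite A"
  shows "|Fpow A| \<le>o |A|"
proof -
  define P where "P n = {F. F \<subseteq> A \<and> finite F \<and> card F = n}" for n :: nat
  have P: "|P n| \<le>o |A|" for n
  proof (induction n)
    case 0
    have "P 0 = {{}}"
      by (auto simp: P_def)
    have "A \<noteq> {}"
      using assms by auto
    then have "|{{} :: 'a set}| \<le>o |A|"
      by (rule card_of_singl_ordLeq)
    with \<open>P 0 = {{}}\<close> show ?case
      by metis
  next
    case (Suc n)
    have "P (Suc n) \<subseteq> (\<lambda>(a, F). insert a F) ` (A \<times> P n)"
    proof
      fix F assume F: "F \<in> P (Suc n)"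
      then have "card F = Suc n"
        by (simp add: P_def)
      then obtain a G where "F = insert a G" "card G = n"
        unfolding card_Suc_eq by blast
      moreover have "a \<in> A" "G \<in> P n"
        using calculation F by (simp_all add: P_def)
      ultimately show "F \<in> (\<lambda>(a, F). insert a F) ` (A \<times> P n)"
        by force
    qed
    then have "|P (Suc n)| \<le>o |A \<times> P n|"
      by (rule surj_imp_ordLeq)
    also have "|A \<times> P n| \<le>o |A|"
      using card_of_Times_ordLeq_infinite_Field[OF _ ordIso_imp_ordLeq[OF card_of_refl] Suc] assms
      by (simp add: Field_card_of card_of_card_order_on)
    finally show ?case .
  qed
  have "Fpow A \<subseteq> (\<Union>n. P n)"
    by (auto simp: Fpow_def P_def)
  then have "|Fpow A| \<le>o |\<Union>n. P n|"
    by (rule card_of_mono1)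
  also have "|\<Union>n. P n| \<le>o |A|"
    using assms P infinite_iff_card_of_nat[of A] by (intro card_of_UNION_ordLeq_infinite) simp_all
  finally show ?thesis .
qed

lemma card_of_Union_finite_sets_ordLess:
  assumes "natLeq <o r" "|\<Phi>| <o r" "\<And>F. F \<in> \<Phi> \<Longrightarrow> finite F"
  shows "|\<Union>\<Phi>| <o r"
proof (cases "finite \<Phi>")
  case True
  then have "finite (\<Union>\<Phi>)"
    using assms(3) by blast
  then have "|\<Union>\<Phi>| <o natLeq"
    by (simp add: finite_iff_ordLess_natLeq)
  then show ?thesis
    using assms(1) by (rule ordLess_transitive)
next
  case False
  then have "natLeq \<le>o |\<Phi>|"
    using infinite_iff_natLeq_ordLeq[of \<Phi>] by auto
  moreover have "|F| <o natLeq" if "F \<in> \<Phi>" for F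
    using assms(3)[OF that] by (simp add: finite_iff_ordLess_natLeq)
  ultimately have "|F| \<le>o |\<Phi>|" if "F \<in> \<Phi>" for F
    using that ordLess_ordLeq_trans ordLess_imp_ordLeq by metis
  then have "|\<Union>F\<in>\<Phi>. F| \<le>o |\<Phi>|"
    using False by (intro card_of_UNION_ordLeq_infinite) (auto intro: card_of_refl ordIso_imp_ordLeq)
  then show ?thesis
    using ordLeq_ordLess_trans[OF _ assms(2)] by simp
qed

lemma card_of_Pow_mono:
  assumes "|A| \<le>o |B|"
  shows "|Pow A| \<le>o |Pow B|"
proof -
  obtain f where f: "inj_on f A" "f ` A \<subseteq> B"
    using assms unfolding card_of_ordLeq[symmetric] by blast
  have "inj_on ((`) f) (Pow A)"
    using f(1) by (simp add: inj_on_image_Pow)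
  then show ?thesis
    by (rule card_of_ordLeqI) (use f(2) in auto)
qed

lemma strong_limit_Pow:
  fixes \<Lambda> :: "'l rel"
  assumes "strong_limit \<Lambda>" "|A| <o \<Lambda>"
  shows "|Pow A| <o \<Lambda>"
proof -
  obtain B :: "'l set" where B: "|A| =o |B|" "|B| <o \<Lambda>"
    using internalize_card_of_ordLess[of A \<Lambda>] assms(2) by blast
  have "|Pow A| \<le>o |Pow B|"
    using B(1) by (intro card_of_Pow_mono ordIso_imp_ordLeq)
  also have "|Pow B| =o ctwo ^c |B|"
    using card_of_Pow_Func[of B] by (simp add: cexp_def ctwo_def Field_card_of)
  also have "ctwo ^c |B| <o \<Lambda>"
    using assms(1) B(2) card_of_Card_order unfolding strong_limit_def by blast
  finally show ?thesis .
qed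

lemma ordLeq_imp_subset_ordIso:
  fixes r :: "'r rel"
  assumes "Card_order r" "r \<le>o |A|"
  obtains B where "B \<subseteq> A" "|B| =o r"
proof -
  have "|Field r| =o r"
    using assms(1) card_of_Field_ordIso by blast
  moreover obtain B where B: "B \<subseteq> A" "|Field r| =o |B|"
    using internalize_card_of_ordLeq2[of "Field r" A] ordIso_ordLeq_trans[OF calculation assms(2)]
    by blast
  ultimately have "|B| =o r"
    using ordIso_transitive[OF ordIso_symmetric] by blast
  then show thesis
    using B(1) that by blast
qed

section \<open>Ultrafilters\<close>

lemma ultrafilter_over_subset: "ultrafilter_over S D \<Longrightarrow> A \<in> D \<Longrightarrow> A \<subseteq> S"
  by (auto simp: ultrafilter_over_def)

lemma ultrafilter_over_nonempty: "ultrafilter_over S D \<Longrightarrow> A \<in> D \<Longrightarrow> A \<noteq> {}"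
  by (auto simp: ultrafilter_over_def)

lemma ultrafilter_over_Int: "ultrafilter_over S D \<Longrightarrow> A \<in> D \<Longrightarrow> B \<in> D \<Longrightarrow> A \<inter> B \<in> D"
  by (simp add: ultrafilter_over_def)

lemma ultrafilter_over_mono:
  "ultrafilter_over S D \<Longrightarrow> A \<in> D \<Longrightarrow> A \<subseteq> B \<Longrightarrow> B \<subseteq> S \<Longrightarrow> B \<in> D"
  by (simp add: ultrafilter_over_def)

text \<open>
  The ultrafilter \<open>D\<close> over \<open>S\<close> as a filter in the sense of limits, so that \<open>limitin\<close> expresses
  convergence along \<open>D\<close>.
\<close>

definition along :: "'s set \<Rightarrow> 's set set \<Rightarrow> 's filter" where
  "along S D = Abs_filter (\<lambda>P. {s \<in> S. P s} \<in> D)"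

lemma eventually_along:
  assumes "ultrafilter_over S D"
  shows "eventually P (along S D) \<longleftrightarrow> {s \<in> S. P s} \<in> D"
  unfolding along_def
proof (rule eventually_Abs_filter, rule is_filter.intro)
  show "{s \<in> S. True} \<in> D"
    using assms by (simp add: ultrafilter_over_def)
next
  fix P Q assume "{s \<in> S. P s} \<in> D" "{s \<in> S. Q s} \<in> D"
  then have "{s \<in> S. P s} \<inter> {s \<in> S. Q s} \<in> D"
    by (rule ultrafilter_over_Int[OF assms])
  also have "{s \<in> S. P s} \<inter> {s \<in> S. Q s} = {s \<in> S. P s \<and> Q s}"
    by blast
  finally show "{s \<in> S. P s \<and> Q s} \<in> D" .
next
  fix P Q :: "'a \<Rightarrow> bool" assume "\<forall>s. P s \<longrightarrow> Q s" "{s \<in> S. P s} \<in> D"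
  moreover have "{s \<in> S. P s} \<subseteq> {s \<in> S. Q s}" "{s \<in> S. Q s} \<subseteq> S"
    using calculation by blast+
  ultimately show "{s \<in> S. Q s} \<in> D"
    using ultrafilter_over_mono[OF assms] by blast
qed

lemma ultrafilter_over_Diff_iff:
  assumes "ultrafilter_over S D" "A \<subseteq> S"
  shows "S - A \<in> D \<longleftrightarrow> A \<notin> D"
proof -
  have "A \<inter> (S - A) = {}"
    by blast
  then show ?thesis
    using assms unfolding ultrafilter_over_def by metis
qed

lemma ultrafilter_extends_filter_base:
  assumes "B \<subseteq> Pow S" "B \<noteq> {}" "{} \<notin> B"
    and base: "\<And>A A'. A \<in> B \<Longrightarrow> A' \<in> B \<Longrightarrow> \<exists>C\<in>B. C \<subseteq> A \<inter> A'"
  obtains D where "ultrafilter_over S D" "B \<subseteq> D"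
proof -
  \<comment> \<open>The proper filters over \<open>S\<close> that contain \<open>B\<close>; a maximal one is an ultrafilter.\<close>
  define \<A> where "\<A> = {E. B \<subseteq> E \<and> E \<subseteq> Pow S \<and> S \<in> E \<and> {} \<notin> E \<and>
    (\<forall>A\<in>E. \<forall>A'\<in>E. A \<inter> A' \<in> E) \<and> (\<forall>A\<in>E. \<forall>A'. A \<subseteq> A' \<and> A' \<subseteq> S \<longrightarrow> A' \<in> E)}"
  have \<A>I: "E \<in> \<A>" if "B \<subseteq> E" "E \<subseteq> Pow S" "S \<in> E" "{} \<notin> E"
    "\<And>A A'. A \<in> E \<Longrightarrow> A' \<in> E \<Longrightarrow> A \<inter> A' \<in> E"
    "\<And>A A'. A \<in> E \<Longrightarrow> A \<subseteq> A' \<Longrightarrow> A' \<subseteq> S \<Longrightarrow> A' \<in> E" for E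
    unfolding \<A>_def using that by simp
  have base_le: "B \<subseteq> E" and le_Pow: "E \<subseteq> Pow S" and top_in: "S \<in> E" and empty_notin: "{} \<notin> E"
    if "E \<in> \<A>" for E
    using that by (simp_all add: \<A>_def)
  have Int_in: "A \<inter> A' \<in> E" if "E \<in> \<A>" "A \<in> E" "A' \<in> E" for E A A'
    using that by (simp add: \<A>_def)
  have up_in: "A' \<in> E" if "E \<in> \<A>" "A \<in> E" "A \<subseteq> A'" "A' \<subseteq> S" for E A A'
    using that unfolding \<A>_def by blast
  have generated: "{A. A \<subseteq> S \<and> (\<exists>C\<in>B'. C \<subseteq> A)} \<in> \<A>"
    if B': "B \<subseteq> B'" "B' \<subseteq> Pow S" "{} \<notin> B'"
      and directed: "\<And>A A'. A \<in> B' \<Longrightarrow> A' \<in> B' \<Longrightarrow> \<exists>C\<in>B'. C \<subseteq> A \<inter> A'" for B'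
  proof (rule \<A>I)
    let ?E = "{A. A \<subseteq> S \<and> (\<exists>C\<in>B'. C \<subseteq> A)}"
    show "A \<inter> A' \<in> ?E" if A: "A \<in> ?E" "A' \<in> ?E" for A A'
    proof -
      obtain C1 C2 where C: "C1 \<in> B'" "C1 \<subseteq> A" "C2 \<in> B'" "C2 \<subseteq> A'"
        using A by blast
      obtain C where "C \<in> B'" "C \<subseteq> C1 \<inter> C2"
        using directed[OF C(1,3)] by blast
      then show ?thesis
        using C(2,4) A by blast
    qed
    show "S \<in> ?E"
      using assms(2) B'(1,2) by blast
    show "B \<subseteq> ?E"
      using B'(1,2) by blast
    show "{} \<notin> ?E"
      using B'(3) by auto
    show "A' \<in> ?E" if "A \<in> ?E" "A \<subseteq> A'" "A' \<subseteq> S" for A A'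
      using that by blast
  qed blast
  have "\<A> \<noteq> {}"
    using generated[OF order_refl assms(1,3) base] by blast
  moreover have "\<Union>\<C> \<in> \<A>" if "\<C> \<noteq> {}" and chain: "subset.chain \<A> \<C>" for \<C>
  proof -
    have in_A: "E \<in> \<A>" if "E \<in> \<C>" for E
      using chain that unfolding subset.chain_def by blast
    obtain E0 where "E0 \<in> \<C>"
      using \<open>\<C> \<noteq> {}\<close> by blast
    show ?thesis
    proof (rule \<A>I)
      fix A A' assume "A \<in> \<Union>\<C>" "A' \<in> \<Union>\<C>"
      then obtain E E' where EE': "E \<in> \<C>" "A \<in> E" "E' \<in> \<C>" "A' \<in> E'"
        by blast
      have "E \<subseteq> E' \<or> E' \<subseteq> E"
        using chain EE' unfolding subset.chain_def by blast
      then obtain E'' where "E'' \<in> \<C>" "A \<in> E''" "A' \<in> E''"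
        using EE' by blast
      then show "A \<inter> A' \<in> \<Union>\<C>"
        using Int_in[OF in_A] by blast
    next
      show "B \<subseteq> \<Union>\<C>" "S \<in> \<Union>\<C>"
        using base_le[OF in_A] top_in[OF in_A] \<open>E0 \<in> \<C>\<close> by blast+
      show "\<Union>\<C> \<subseteq> Pow S" "{} \<notin> \<Union>\<C>"
        using le_Pow[OF in_A] empty_notin[OF in_A] by blast+
    next
      fix A A' assume "A \<in> \<Union>\<C>" "A \<subseteq> A'" "A' \<subseteq> S"
      then show "A' \<in> \<Union>\<C>"
        using up_in[OF in_A] by blast
    qed
  qed
  ultimately obtain D where D: "D \<in> \<A>" and max: "\<And>E. E \<in> \<A> \<Longrightarrow> D \<subseteq> E \<Longrightarrow> E = D"
    using subset_Zorn_nonempty[of \<A>] by metis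
  have ultra: "S - A \<in> D" if "A \<subseteq> S" "A \<notin> D" for A
  proof (rule ccontr)
    assume "S - A \<notin> D"
    \<comment> \<open>If \<open>A\<close> and its complement are both missing, \<open>D\<close> and \<open>A\<close> generate a larger proper filter.\<close>
    define B' where "B' = D \<union> (\<lambda>C. C \<inter> A) ` D"
    have "\<exists>C\<in>B'. C \<subseteq> A1 \<inter> A2" if A12: "A1 \<in> B'" "A2 \<in> B'" for A1 A2
    proof -
      obtain C1 C2 where C: "C1 \<in> D" "C1 \<inter> A \<subseteq> A1" "C2 \<in> D" "C2 \<inter> A \<subseteq> A2"
        using A12 unfolding B'_def by blast
      then have "C1 \<inter> C2 \<in> D"
        using Int_in[OF D] by blast
      then have "(C1 \<inter> C2) \<inter> A \<in> B'"
        by (simp add: B'_def)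
      moreover have "(C1 \<inter> C2) \<inter> A \<subseteq> A1 \<inter> A2"
        using C by blast
      ultimately show ?thesis by blast
    qed
    moreover have "B \<subseteq> B'" "B' \<subseteq> Pow S"
      using base_le[OF D] le_Pow[OF D] unfolding B'_def by blast+
    moreover have "{} \<notin> B'"
    proof
      assume "{} \<in> B'"
      then obtain C where "C \<in> D" "C \<inter> A = {}"
        using empty_notin[OF D] unfolding B'_def by blast
      then have "C \<subseteq> S - A"
        using le_Pow[OF D] by blast
      then show False
        using up_in[OF D \<open>C \<in> D\<close>] \<open>S - A \<notin> D\<close> by blast
    qed
    ultimately have "{A. A \<subseteq> S \<and> (\<exists>C\<in>B'. C \<subseteq> A)} \<in> \<A>"
      by (intro generated)
    moreover have "D \<subseteq> {A. A \<subseteq> S \<and> (\<exists>C\<in>B'. C \<subseteq> A)}"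
      using le_Pow[OF D] unfolding B'_def by blast
    ultimately have "{A. A \<subseteq> S \<and> (\<exists>C\<in>B'. C \<subseteq> A)} = D"
      by (rule max)
    moreover have "S \<inter> A \<in> B'"
      using top_in[OF D] by (simp add: B'_def)
    ultimately show False
      using that by blast
  qed
  have "\<forall>A\<subseteq>S. A \<in> D \<or> S - A \<in> D"
    using ultra by blast
  then have "ultrafilter_over S D"
    unfolding ultrafilter_over_def
    using le_Pow[OF D] top_in[OF D] empty_notin[OF D] Int_in[OF D] up_in[OF D] by simp
  then show thesis
    using base_le[OF D] by (rule that)
qed

section \<open>Divergent maps into regular cardinals\<close>

text \<open>
  An ultrafilter that is not \<open>\<mu>\<close>-complete is not \<open>\<mu>\<close>-complete because of a family indexed by a regular
  cardinal below \<open>\<mu>\<close>; regularity comes from the minimality of the index set.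
\<close>

lemma not_complete_imp_divergent:
  fixes \<mu> :: "'m rel"
  assumes D: "ultrafilter_over S D" and "\<not> complete_ultrafilter \<mu> D"
  obtains \<kappa> :: "'m rel" and f where "Cinfinite \<kappa>" "regularCard \<kappa>" "\<kappa> <o \<mu>"
    "f ` S \<subseteq> Field \<kappa>" "\<And>i. i \<in> Field \<kappa> \<Longrightarrow> {s \<in> S. f s \<in> underS \<kappa> i} \<notin> D"
proof -
  define bad where "bad K \<longleftrightarrow> K \<noteq> {} \<and> (\<exists>A. A ` K \<subseteq> D \<and> \<Inter>(A ` K) \<notin> D)" for K :: "'m set"
  obtain \<G> where \<G>: "\<G> \<subseteq> D" "\<G> \<noteq> {}" "|\<G>| <o \<mu>" "\<Inter>\<G> \<notin> D"
    using assms(2) unfolding complete_ultrafilter_def by blast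
  then obtain K1 :: "'m set" where K1: "|\<G>| =o |K1|" "|K1| <o \<mu>"
    using internalize_card_of_ordLess[of \<G> \<mu>] by blast
  obtain h where "bij_betw h K1 \<G>"
    using ordIso_symmetric[OF K1(1)] unfolding card_of_ordIso[symmetric] by blast
  then have "h ` K1 = \<G>"
    by (rule bij_betw_imp_surj_on)
  then have "bad K1"
    using \<G> unfolding bad_def by blast
  define R where "R = {|K| | K. bad K}"
  have "R \<noteq> {}" "\<forall>r\<in>R. Well_order r"
    using \<open>bad K1\<close> card_of_Well_order unfolding R_def by blast+
  then obtain r where "r \<in> R" "\<forall>r'\<in>R. r \<le>o r'"
    using exists_minim_Well_order by metis
  then obtain K where "bad K" and least: "\<And>I. bad I \<Longrightarrow> |K| \<le>o |I|"
    unfolding R_def by blast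
  then obtain A where A: "K \<noteq> {}" "A ` K \<subseteq> D" "\<Inter>(A ` K) \<notin> D"
    unfolding bad_def by blast
  note Int_in = ultrafilter_over_Int[OF D]
  have small: "\<Inter>(B ` I) \<in> D" if "I \<noteq> {}" "|I| <o |K|" "B ` I \<subseteq> D" for I :: "'m set" and B
  proof (rule ccontr)
    assume "\<Inter>(B ` I) \<notin> D"
    then have "bad I"
      using that unfolding bad_def by blast
    then show False
      using least not_ordLess_ordLeq that(2) by blast
  qed
  have "infinite K"
  proof
    assume "finite K"
    then have "\<Inter>(A ` K) \<in> D"
      using A(1,2) by (induction rule: finite_ne_induct) (auto intro: Int_in)
    then show False
      using A(3) by blast
  qed
  let ?\<kappa> = "|K|"
  have Field: "Field ?\<kappa> = K"
    by (rule Field_card_of)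
  have Cinf: "Cinfinite ?\<kappa>"
    using \<open>infinite K\<close> card_of_card_order_on by (simp add: cinfinite_def Field)
  have "?\<kappa> <o \<mu>"
    using least[OF \<open>bad K1\<close>] K1(2) by (rule ordLeq_ordLess_trans)
  have wo: "wo_rel ?\<kappa>"
    using card_of_Well_order by (simp add: wo_rel_def)
  \<comment> \<open>The decreasing family of the partial intersections, which lie in \<open>D\<close> by minimality.\<close>
  define B where "B i = \<Inter>(A ` under ?\<kappa> i)" for i
  have self: "i \<in> under ?\<kappa> i" if "i \<in> K" for i
    using wo_rel.REFL[OF wo] that by (simp add: under_def refl_on_def Field)
  have under_le: "under ?\<kappa> i \<subseteq> K" for i
    using under_Field[of ?\<kappa> i] unfolding Field .
  have B: "B i \<in> D" if "i \<in> K" for i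
    unfolding B_def
  proof (rule small)
    show "under ?\<kappa> i \<noteq> {}"
      using self[OF that] by blast
    have "under ?\<kappa> i = insert i (underS ?\<kappa> i)"
      using self[OF that] by (auto simp: under_def underS_def)
    have "\<exists>j\<in>Field ?\<kappa>. i \<noteq> j \<and> (i, j) \<in> ?\<kappa>"
      using Cinf that by (intro infinite_Card_order_limit) (simp_all add: cinfinite_def Field)
    then obtain j where j: "j \<in> K" "i \<noteq> j" "(i, j) \<in> ?\<kappa>"
      unfolding Field by blast
    then have "under ?\<kappa> i \<subseteq> underS ?\<kappa> j"
      using wo_rel.TRANS[OF wo] wo_rel.ANTISYM[OF wo]
      by (auto simp: under_def underS_def trans_def antisym_def)
    then have "|under ?\<kappa> i| \<le>o |underS ?\<kappa> j|"
      by (rule card_of_mono1)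
    also have "|underS ?\<kappa> j| <o ?\<kappa>"
      using j(1) by (intro card_of_underS card_of_Card_order) (simp add: Field)
    finally show "|under ?\<kappa> i| <o ?\<kappa>" .
    show "A ` under ?\<kappa> i \<subseteq> D"
      using A(2) under_le by blast
  qed
  have "regularCard ?\<kappa>"
    unfolding regularCard_def Field
  proof (intro allI impI, elim conjE)
    fix C assume "C \<subseteq> K" "cofinal C ?\<kappa>"
    show "|C| =o ?\<kappa>"
    proof (rule ccontr)
      assume "\<not> |C| =o ?\<kappa>"
      then have "|C| <o ?\<kappa>"
        using card_of_mono1[OF \<open>C \<subseteq> K\<close>] ordLeq_iff_ordLess_or_ordIso by blast
      have above: "\<exists>i\<in>C. j \<in> under ?\<kappa> i" if "j \<in> K" for j
        using \<open>cofinal C ?\<kappa>\<close> that unfolding cofinal_def under_def Field by blast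
      then have "\<Inter>(B ` C) \<subseteq> \<Inter>(A ` K)"
        unfolding B_def by blast
      moreover have "\<Inter>(A ` K) \<subseteq> \<Inter>(B ` C)"
        using under_le unfolding B_def by blast
      moreover have "\<Inter>(B ` C) \<in> D"
      proof (rule small)
        show "C \<noteq> {}"
          using A(1) above by blast
        show "B ` C \<subseteq> D"
          using B \<open>C \<subseteq> K\<close> by blast
      qed fact
      ultimately show False
        using A(3) by simp
    qed
  qed
  \<comment> \<open>The value of \<open>f\<close> on \<open>\<Inter>(A ` K)\<close>, which is not in \<open>D\<close>, does not matter.\<close>
  have "\<exists>i\<in>K. s \<in> \<Inter>(A ` K) \<or> s \<notin> A i" for s
    using A(1) by blast
  then obtain f where f: "\<And>s. f s \<in> K" "\<And>s. s \<notin> \<Inter>(A ` K) \<Longrightarrow> s \<notin> A (f s)"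
    by metis
  have "\<Inter>(A ` K) \<subseteq> S"
    using A(1,2) ultrafilter_over_subset[OF D] by blast
  then have co: "S - \<Inter>(A ` K) \<in> D"
    using A(3) D by (simp add: ultrafilter_over_Diff_iff)
  have "{s \<in> S. f s \<in> underS ?\<kappa> i} \<notin> D" if "i \<in> K" for i
  proof
    assume "{s \<in> S. f s \<in> underS ?\<kappa> i} \<in> D"
    then have "{s \<in> S. f s \<in> underS ?\<kappa> i} \<inter> (B i \<inter> (S - \<Inter>(A ` K))) \<in> D"
      using B[OF that] co by (intro Int_in)
    moreover have "{s \<in> S. f s \<in> underS ?\<kappa> i} \<inter> (B i \<inter> (S - \<Inter>(A ` K))) = {}"
      using f(2) unfolding B_def underS_def under_def by blast
    ultimately show False
      using ultrafilter_over_nonempty[OF D] by metis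
  qed
  moreover have "f ` S \<subseteq> K"
    using f(1) by blast
  ultimately show thesis
    using that[of ?\<kappa> f] Cinf \<open>regularCard ?\<kappa>\<close> \<open>?\<kappa> <o \<mu>\<close> by (simp add: Field)
qed

lemma not_limitin_rel_order_topology:
  assumes "ultrafilter_over S D" "Cinfinite \<kappa>"
    and "\<And>i. i \<in> Field \<kappa> \<Longrightarrow> {s \<in> S. f s \<in> underS \<kappa> i} \<notin> D"
  shows "\<not> limitin (rel_order_topology \<kappa>) f l (along S D)"
proof
  assume lim: "limitin (rel_order_topology \<kappa>) f l (along S D)"
  then have "l \<in> Field \<kappa>"
    by (simp add: limitin_def)
  then obtain i where i: "i \<in> Field \<kappa>" "l \<noteq> i" "(l, i) \<in> \<kappa>"
    using infinite_Card_order_limit[of \<kappa> l] assms(2) by (auto simp: cinfinite_def)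
  have "openin (rel_order_topology \<kappa>) (underS \<kappa> i)"
    unfolding rel_order_topology_def using i(1) by (intro topology_generated_by_Basis) simp
  moreover have "l \<in> underS \<kappa> i"
    using i by (simp add: underS_def)
  ultimately have "\<forall>\<^sub>F s in along S D. f s \<in> underS \<kappa> i"
    using lim by (simp add: limitin_def)
  then show False
    using assms(3)[OF i(1)] by (simp add: eventually_along[OF assms(1)])
qed

section \<open>Fine ultrafilters\<close>

text \<open>
  The subsets of \<open>\<Lambda>\<close> of cardinality less than \<open>\<mu>\<close>, with \<open>Field \<Lambda>\<close> as the underlying set of \<open>\<Lambda>\<close>.
\<close>

definition small_subsets :: "'m rel \<Rightarrow> 'l rel \<Rightarrow> 'l set set" where
  "small_subsets \<mu> \<Lambda> = {s. s \<subseteq> Field \<Lambda> \<and> |s| <o \<mu>}"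

text \<open>
  Ultrafilters over the small subsets that contain every cone above a finite set; by closure under
  intersections the cones above singletons would give the same notion.
\<close>

definition fine_ultrafilter :: "'m rel \<Rightarrow> 'l rel \<Rightarrow> 'l set set set \<Rightarrow> bool" where
  "fine_ultrafilter \<mu> \<Lambda> D \<longleftrightarrow> ultrafilter_over (small_subsets \<mu> \<Lambda>) D \<and>
     (\<forall>F\<in>Fpow (Field \<Lambda>). {s \<in> small_subsets \<mu> \<Lambda>. F \<subseteq> s} \<in> D)"

lemma finite_in_small_subsets:
  assumes "natLeq <o \<mu>" "F \<in> Fpow (Field \<Lambda>)"
  shows "F \<in> small_subsets \<mu> \<Lambda>"
proof -
  have "|F| <o natLeq"
    using assms(2) by (simp add: Fpow_def flip: finite_iff_ordLess_natLeq)
  then have "|F| <o \<mu>"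
    using assms(1) by (rule ordLess_transitive)
  then show ?thesis
    using assms(2) by (simp add: Fpow_def small_subsets_def)
qed

lemma fine_imp_regular_ultrafilter:
  assumes "Card_order \<Lambda>" "natLeq <o \<mu>" "fine_ultrafilter \<mu> \<Lambda> D"
  shows "regular_ultrafilter \<mu> \<Lambda> D"
proof -
  define cone where "cone a = {s \<in> small_subsets \<mu> \<Lambda>. {a} \<subseteq> s}" for a
  have "inj_on cone (Field \<Lambda>)"
  proof
    fix a b assume "a \<in> Field \<Lambda>" "b \<in> Field \<Lambda>" "cone a = cone b"
    moreover have "{a} \<in> small_subsets \<mu> \<Lambda>"
      using assms(2) calculation(1) by (intro finite_in_small_subsets) (auto simp: Fpow_def)
    ultimately show "a = b"
      unfolding cone_def by blast
  qed
  then have "|Field \<Lambda>| =o |cone ` Field \<Lambda>|"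
    by (rule card_of_ordIsoI[OF inj_on_imp_bij_betw])
  then have card: "|cone ` Field \<Lambda>| =o \<Lambda>"
    using ordIso_transitive[OF ordIso_symmetric card_of_Field_ordIso[OF assms(1)]] by blast
  have "cone ` Field \<Lambda> \<subseteq> D"
    using assms(3) by (auto simp: fine_ultrafilter_def cone_def Fpow_def)
  moreover have "\<Inter>\<G> = {}" if \<G>: "\<G> \<subseteq> cone ` Field \<Lambda>" "|\<G>| =o \<mu>" for \<G>
  proof (rule ccontr)
    assume "\<Inter>\<G> \<noteq> {}"
    then obtain s where s: "\<And>G. G \<in> \<G> \<Longrightarrow> s \<in> G"
      by blast
    have "\<G> \<noteq> {}"
    proof
      assume "\<G> = {}"
      then have "|\<G>| <o natLeq"
        by (simp flip: finite_iff_ordLess_natLeq)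
      then have "|\<G>| <o \<mu>"
        using assms(2) by (rule ordLess_transitive)
      then show False
        using not_ordLess_ordIso \<G>(2) by blast
    qed
    then have "|s| <o \<mu>"
      using s \<G>(1) by (auto simp: cone_def small_subsets_def)
    have "\<G> \<subseteq> cone ` s"
      using s \<G>(1) unfolding cone_def by blast
    then have "|\<G>| \<le>o |s|"
      by (rule surj_imp_ordLeq)
    then have "|\<G>| <o \<mu>"
      using \<open>|s| <o \<mu>\<close> by (rule ordLeq_ordLess_trans)
    then show False
      using not_ordLess_ordIso \<G>(2) by blast
  qed
  ultimately show ?thesis
    unfolding regular_ultrafilter_def using card by (intro exI[of _ "cone ` Field \<Lambda>"]) simp
qed

section \<open>Compactness and convergence along ultrafilters\<close>

lemma interval_compact_if_small:
  assumes "|topspace X| <o \<mu>"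
  shows "interval_compact \<mu> \<Lambda> X"
  unfolding interval_compact_def
proof (intro allI impI, elim conjE)
  fix \<U> assume cover: "\<Union>\<U> = topspace X"
  then have "\<forall>x\<in>topspace X. \<exists>U. U \<in> \<U> \<and> x \<in> U"
    by blast
  then obtain U where U: "\<forall>x\<in>topspace X. U x \<in> \<U> \<and> x \<in> U x"
    by (rule bchoice[elim_format]) blast
  have "|U ` topspace X| <o \<mu>"
    using card_of_image assms by (rule ordLeq_ordLess_trans)
  moreover have "U ` topspace X \<subseteq> \<U>" "\<Union>(U ` topspace X) = topspace X"
    using U cover by blast+
  ultimately show "\<exists>\<V>. \<V> \<subseteq> \<U> \<and> \<Union>\<V> = topspace X \<and> |\<V>| <o \<mu>"
    by blast
qed

lemma interval_compactD_indexed: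
  assumes "interval_compact \<mu> \<Lambda> X" "|I| \<le>o \<Lambda>"
    and "\<And>i. i \<in> I \<Longrightarrow> openin X (U i)" "topspace X \<subseteq> \<Union>(U ` I)"
  obtains I' where "I' \<subseteq> I" "|I'| <o \<mu>" "topspace X \<subseteq> \<Union>(U ` I')"
proof -
  have "|U ` I| \<le>o \<Lambda>"
    using card_of_image assms(2) by (rule ordLeq_transitive)
  moreover have "\<Union>(U ` I) = topspace X"
    using assms(3,4) openin_subset by blast
  moreover have "\<forall>V\<in>U ` I. openin X V"
    using assms(3) by blast
  ultimately have "\<exists>\<V>. \<V> \<subseteq> U ` I \<and> \<Union>\<V> = topspace X \<and> |\<V>| <o \<mu>"
    by (intro assms(1)[unfolded interval_compact_def, rule_format] conjI)
  then obtain \<V> where \<V>: "\<V> \<subseteq> U ` I" "\<Union>\<V> = topspace X" "|\<V>| <o \<mu>"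
    by blast
  obtain I' where I': "I' \<subseteq> I" "inj_on U I'" "\<V> = U ` I'"
    using \<V>(1) unfolding subset_image_inj by blast
  have "|I'| =o |\<V>|"
    unfolding I'(3) using I'(2) by (rule card_of_ordIsoI[OF inj_on_imp_bij_betw])
  then have "|I'| <o \<mu>"
    using \<V>(3) by (rule ordIso_ordLess_trans)
  moreover have "topspace X \<subseteq> \<Union>(U ` I')"
    using \<V>(2) I'(3) by simp
  ultimately show thesis
    using I'(1) by (intro that)
qed

text \<open>
  Here \<open>x\<close> is regarded as a net over the finite subsets of \<open>\<Lambda>\<close>: its tail at \<open>F\<close> consists of the points
  \<open>x s\<close> with \<open>F \<subseteq> s\<close>. Fewer than \<open>\<mu>\<close> finite sets have a union \<open>s\<close> of cardinality below \<open>\<mu>\<close>, so the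
  corresponding tails have the point \<open>x s\<close> in common.
\<close>

lemma interval_compact_accumulation_point:
  assumes "Card_order \<Lambda>" "natLeq <o \<mu>" "\<mu> \<le>o \<Lambda>" "interval_compact \<mu> \<Lambda> X"
    and x: "\<And>s. s \<in> small_subsets \<mu> \<Lambda> \<Longrightarrow> x s \<in> topspace X"
  shows "\<exists>y\<in>topspace X. \<forall>F\<in>Fpow (Field \<Lambda>). \<forall>V. openin X V \<and> y \<in> V \<longrightarrow>
           (\<exists>s\<in>small_subsets \<mu> \<Lambda>. F \<subseteq> s \<and> x s \<in> V)"
proof (rule ccontr)
  assume no_point: "\<not> ?thesis"
  let ?tail = "\<lambda>F. x ` {s \<in> small_subsets \<mu> \<Lambda>. F \<subseteq> s}"
  define U where "U F = topspace X - X closure_of ?tail F" for F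
  have "natLeq <o \<Lambda>"
    using assms(2,3) by (rule ordLess_ordLeq_trans)
  then have "infinite (Field \<Lambda>)"
    using assms(1) by (intro infinite_Field_if_natLeq_ordLess)
  then have "|Fpow (Field \<Lambda>)| \<le>o |Field \<Lambda>|"
    by (rule card_of_Fpow_ordLeq)
  then have "|Fpow (Field \<Lambda>)| \<le>o \<Lambda>"
    using card_of_Field_ordIso[OF assms(1)] by (rule ordLeq_ordIso_trans)
  moreover have "topspace X \<subseteq> \<Union>(U ` Fpow (Field \<Lambda>))"
  proof
    fix y assume "y \<in> topspace X"
    then obtain F V where "F \<in> Fpow (Field \<Lambda>)" "openin X V" "y \<in> V"
      "\<not> (\<exists>s\<in>small_subsets \<mu> \<Lambda>. F \<subseteq> s \<and> x s \<in> V)"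
      using no_point by blast
    moreover from this have "y \<notin> X closure_of ?tail F"
      by (auto simp: in_closure_of)
    ultimately show "y \<in> \<Union>(U ` Fpow (Field \<Lambda>))"
      using \<open>y \<in> topspace X\<close> unfolding U_def by blast
  qed
  ultimately obtain \<Phi> where \<Phi>: "\<Phi> \<subseteq> Fpow (Field \<Lambda>)" "|\<Phi>| <o \<mu>" "topspace X \<subseteq> \<Union>(U ` \<Phi>)"
    using interval_compactD_indexed[OF assms(4), of "Fpow (Field \<Lambda>)" U]
    by (auto simp: U_def openin_diff)
  have "|\<Union>\<Phi>| <o \<mu>"
    using \<Phi>(1) by (intro card_of_Union_finite_sets_ordLess assms(2) \<Phi>(2)) (auto simp: Fpow_def)
  moreover have "\<Union>\<Phi> \<subseteq> Field \<Lambda>"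
    using \<Phi>(1) by (auto simp: Fpow_def)
  ultimately have s: "\<Union>\<Phi> \<in> small_subsets \<mu> \<Lambda>"
    by (simp add: small_subsets_def)
  then obtain F where F: "F \<in> \<Phi>" "x (\<Union>\<Phi>) \<in> U F"
    using x \<Phi>(3) by blast
  have "?tail F \<subseteq> topspace X"
    using x by blast
  then have "?tail F \<subseteq> X closure_of ?tail F"
    by (rule closure_of_subset)
  moreover have "x (\<Union>\<Phi>) \<in> ?tail F"
    using s F(1) by blast
  ultimately show False
    using F(2) unfolding U_def by blast
qed

lemma interval_compact_fine_limit:
  assumes "Card_order \<Lambda>" "natLeq <o \<mu>" "\<mu> \<le>o \<Lambda>" "interval_compact \<mu> \<Lambda> X"
    and x: "\<And>s. s \<in> small_subsets \<mu> \<Lambda> \<Longrightarrow> x s \<in> topspace X"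
  obtains D y where "fine_ultrafilter \<mu> \<Lambda> D" "limitin X x y (along (small_subsets \<mu> \<Lambda>) D)"
proof -
  obtain y where y: "y \<in> topspace X" "\<forall>F\<in>Fpow (Field \<Lambda>). \<forall>V. openin X V \<and> y \<in> V \<longrightarrow>
      (\<exists>s\<in>small_subsets \<mu> \<Lambda>. F \<subseteq> s \<and> x s \<in> V)"
    using interval_compact_accumulation_point[where x = x, OF assms] by (rule bexE)
  let ?S = "small_subsets \<mu> \<Lambda>"
  define E where "E F V = {s \<in> ?S. F \<subseteq> s \<and> x s \<in> V}" for F V
  define B where "B = {E F V | F V. F \<in> Fpow (Field \<Lambda>) \<and> openin X V \<and> y \<in> V}"
  have "E {} (topspace X) \<in> B"
    unfolding B_def using y(1) by (auto simp: Fpow_def)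
  then have "B \<noteq> {}"
    by blast
  have "B \<subseteq> Pow ?S"
    by (auto simp: B_def E_def)
  have "{} \<notin> B"
  proof
    assume "{} \<in> B"
    then obtain F V where "E F V = {}" "F \<in> Fpow (Field \<Lambda>)" "openin X V" "y \<in> V"
      unfolding B_def by auto
    then show False
      using y(2) unfolding E_def by blast
  qed
  have base: "\<exists>C\<in>B. C \<subseteq> A \<inter> A'" if "A \<in> B" "A' \<in> B" for A A'
  proof -
    obtain F V F' V' where FV: "A = E F V" "F \<in> Fpow (Field \<Lambda>)" "openin X V" "y \<in> V"
      "A' = E F' V'" "F' \<in> Fpow (Field \<Lambda>)" "openin X V'" "y \<in> V'"
      using \<open>A \<in> B\<close> \<open>A' \<in> B\<close> unfolding B_def by auto
    have "F \<union> F' \<in> Fpow (Field \<Lambda>)" "openin X (V \<inter> V')" "y \<in> V \<inter> V'"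
      using FV by (auto simp: Fpow_def)
    then have "E (F \<union> F') (V \<inter> V') \<in> B"
      unfolding B_def by blast
    moreover have "E (F \<union> F') (V \<inter> V') \<subseteq> A \<inter> A'"
      unfolding E_def FV by blast
    ultimately show ?thesis
      by blast
  qed
  obtain D where D: "ultrafilter_over ?S D" "B \<subseteq> D"
    using ultrafilter_extends_filter_base[OF \<open>B \<subseteq> Pow ?S\<close> \<open>B \<noteq> {}\<close> \<open>{} \<notin> B\<close> base] by blast
  have in_D: "A \<in> D" if "F \<in> Fpow (Field \<Lambda>)" "openin X V" "y \<in> V" "E F V \<subseteq> A" "A \<subseteq> ?S" for F V A
  proof -
    have "E F V \<in> B"
      unfolding B_def using that by blast
    then show ?thesis
      using ultrafilter_over_mono[OF D(1)] D(2) that(4,5) by blast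
  qed
  have "{s \<in> ?S. F \<subseteq> s} \<in> D" if "F \<in> Fpow (Field \<Lambda>)" for F
    by (rule in_D[OF that openin_topspace y(1)]) (auto simp: E_def)
  then have "fine_ultrafilter \<mu> \<Lambda> D"
    using D(1) by (simp add: fine_ultrafilter_def)
  moreover have "{s \<in> ?S. x s \<in> V} \<in> D" if "openin X V" "y \<in> V" for V
    by (rule in_D[OF empty_in_Fpow that]) (auto simp: E_def)
  then have "limitin X x y (along ?S D)"
    using y(1) by (simp add: limitin_def eventually_along[OF D(1)])
  ultimately show thesis
    by (rule that)
qed

section \<open>Productivity implies \<open>\<Lambda>\<close>-compactness\<close>

text \<open>
  The factors of the product are indexed by the fine ultrafilters themselves, and this determines
  the type of index sets in the premise.
\<close>

theorem productive_for_regular_below_imp_compact_cardinal: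
  fixes \<mu> :: "'m rel" and \<Lambda> :: "'l rel"
  assumes "Card_order \<mu>" "Card_order \<Lambda>" "natLeq <o \<mu>" "\<mu> \<le>o \<Lambda>"
    and productive: "productive_for TYPE('l set set set) \<mu> \<Lambda> (regular_below \<mu>)"
  shows "compact_cardinal TYPE('l set) \<mu> \<Lambda>"
proof (rule ccontr)
  assume not_compact: "\<not> compact_cardinal TYPE('l set) \<mu> \<Lambda>"
  let ?S = "small_subsets \<mu> \<Lambda>"
  define J where "J = {D. fine_ultrafilter \<mu> \<Lambda> D}"
  have ultra: "ultrafilter_over ?S D" if "D \<in> J" for D
    using that by (simp add: J_def fine_ultrafilter_def)
  have "\<exists>\<kappa> :: 'm rel. \<exists>f. Cinfinite \<kappa> \<and> regularCard \<kappa> \<and> \<kappa> <o \<mu> \<and> f ` ?S \<subseteq> Field \<kappa> \<and>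
      (\<forall>i\<in>Field \<kappa>. {s \<in> ?S. f s \<in> underS \<kappa> i} \<notin> D)"
    if D: "D \<in> J" for D
  proof -
    have "regular_ultrafilter \<mu> \<Lambda> D"
      using D assms(2,3) by (intro fine_imp_regular_ultrafilter) (simp_all add: J_def)
    then have "\<not> complete_ultrafilter \<mu> D"
      using not_compact ultra[OF D] assms(1,3) unfolding compact_cardinal_def by blast
    then obtain \<kappa> :: "'m rel" and f where "Cinfinite \<kappa>" "regularCard \<kappa>" "\<kappa> <o \<mu>"
      "f ` ?S \<subseteq> Field \<kappa>" "\<And>i. i \<in> Field \<kappa> \<Longrightarrow> {s \<in> ?S. f s \<in> underS \<kappa> i} \<notin> D"
      using not_complete_imp_divergent[OF ultra[OF D]] by blast
    then show ?thesis
      by (intro exI[of _ \<kappa>] exI[of _ f]) simp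
  qed
  then have "\<forall>D\<in>J. \<exists>\<kappa> :: 'm rel. \<exists>f. Cinfinite \<kappa> \<and> regularCard \<kappa> \<and> \<kappa> <o \<mu> \<and>
      f ` ?S \<subseteq> Field \<kappa> \<and> (\<forall>i\<in>Field \<kappa>. {s \<in> ?S. f s \<in> underS \<kappa> i} \<notin> D)"
    by (rule ballI)
  from bchoice[OF this] obtain \<kappa> :: "'l set set set \<Rightarrow> 'm rel" where
    "\<forall>D\<in>J. \<exists>f. Cinfinite (\<kappa> D) \<and> regularCard (\<kappa> D) \<and> \<kappa> D <o \<mu> \<and>
      f ` ?S \<subseteq> Field (\<kappa> D) \<and> (\<forall>i\<in>Field (\<kappa> D). {s \<in> ?S. f s \<in> underS (\<kappa> D) i} \<notin> D)"
    by (rule exE)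
  from bchoice[OF this] obtain f where
    f: "\<forall>D\<in>J. Cinfinite (\<kappa> D) \<and> regularCard (\<kappa> D) \<and> \<kappa> D <o \<mu> \<and>
      f D ` ?S \<subseteq> Field (\<kappa> D) \<and> (\<forall>i\<in>Field (\<kappa> D). {s \<in> ?S. f D s \<in> underS (\<kappa> D) i} \<notin> D)"
    by (rule exE)
  have \<kappa>: "Cinfinite (\<kappa> D)" "regularCard (\<kappa> D)" "\<kappa> D <o \<mu>" "f D ` ?S \<subseteq> Field (\<kappa> D)"
    "\<And>i. i \<in> Field (\<kappa> D) \<Longrightarrow> {s \<in> ?S. f D s \<in> underS (\<kappa> D) i} \<notin> D" if "D \<in> J" for D
    using bspec[OF f that] by simp_all
  define X where "X D = rel_order_topology (\<kappa> D)" for D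
  have "X D \<in> regular_below \<mu>" if "D \<in> J" for D
    unfolding regular_below_def X_def using \<kappa>(1-3)[OF that] by blast
  moreover have "interval_compact \<mu> \<Lambda> (X D)" if "D \<in> J" for D
    using ordLess_Field[OF \<kappa>(3)[OF that]]
    by (intro interval_compact_if_small) (simp add: X_def)
  ultimately have compact: "interval_compact \<mu> \<Lambda> (product_topology X J)"
    using productive unfolding productive_for_def by blast
  define x where "x s = (\<lambda>D\<in>J. f D s)" for s
  have x: "x s \<in> topspace (product_topology X J)" if "s \<in> ?S" for s
    using \<kappa>(4) that by (auto simp: x_def X_def)
  obtain D y where D: "fine_ultrafilter \<mu> \<Lambda> D"
    and lim: "limitin (product_topology X J) x y (along ?S D)"
    using compact x by (rule interval_compact_fine_limit[OF assms(2-4)])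
  have "D \<in> J"
    using D by (simp add: J_def)
  then have "limitin (X D) (\<lambda>s. x s D) (y D) (along ?S D)"
    using lim by (simp add: limitin_componentwise)
  then have "limitin (rel_order_topology (\<kappa> D)) (f D) (y D) (along ?S D)"
    using \<open>D \<in> J\<close> by (simp add: x_def X_def)
  then show False
    using not_limitin_rel_order_topology[OF ultra \<kappa>(1,5)] \<open>D \<in> J\<close> by blast
qed

section \<open>\<open>\<Lambda>\<close>-compactness implies productivity\<close>

text \<open>
  The size of \<open>S\<close> plays no role: whether \<open>l\<close> is a limit depends only on the traces of its open
  neighbourhoods on \<open>x ` S\<close>, and the number of traces is at most \<open>\<Lambda>\<close>.
\<close>

lemma complete_ultrafilter_limit:
  assumes D: "ultrafilter_over S D" and complete: "complete_ultrafilter \<mu> D"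
    and X: "interval_compact \<mu> \<Lambda> X" and x: "x ` S \<subseteq> topspace X" and card: "|Pow (x ` S)| \<le>o \<Lambda>"
  shows "\<exists>l. limitin X x l (along S D)"
proof (rule ccontr)
  assume no_limit: "\<not> ?thesis"
  \<comment> \<open>The largest open set with trace \<open>Y\<close> on the range of \<open>x\<close>, or empty if there is none.\<close>
  define W where "W Y = \<Union>{U. openin X U \<and> U \<inter> x ` S = Y}" for Y
  define \<Y> where "\<Y> = {Y \<in> Pow (x ` S). {s \<in> S. x s \<in> Y} \<notin> D}"
  have cover: "topspace X \<subseteq> \<Union>(W ` \<Y>)"
  proof
    fix l assume "l \<in> topspace X"
    then obtain U where U: "openin X U" "l \<in> U" "{s \<in> S. x s \<in> U} \<notin> D"
      using no_limit by (auto simp: limitin_def eventually_along[OF D])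
    have "{s \<in> S. x s \<in> U \<inter> x ` S} = {s \<in> S. x s \<in> U}"
      by blast
    then have "U \<inter> x ` S \<in> \<Y>"
      using U(3) unfolding \<Y>_def by simp
    moreover have "l \<in> W (U \<inter> x ` S)"
      unfolding W_def using U(1,2) by blast
    ultimately show "l \<in> \<Union>(W ` \<Y>)"
      by blast
  qed
  have "\<Y> \<subseteq> Pow (x ` S)"
    by (auto simp: \<Y>_def)
  then have "|\<Y>| \<le>o \<Lambda>"
    using ordLeq_transitive[OF card_of_mono1 card] by blast
  moreover have "openin X (W Y)" if "Y \<in> \<Y>" for Y
    unfolding W_def by (rule openin_Union) simp
  ultimately obtain \<Z> where \<Z>: "\<Z> \<subseteq> \<Y>" "|\<Z>| <o \<mu>" "topspace X \<subseteq> \<Union>(W ` \<Z>)"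
    using cover by (rule interval_compactD_indexed[OF X])
  have covered: "\<exists>Y\<in>\<Z>. x s \<in> Y" if "s \<in> S" for s
  proof -
    have "x s \<in> \<Union>(W ` \<Z>)"
      using \<Z>(3) x that by blast
    then obtain U where U: "U \<inter> x ` S \<in> \<Z>" "x s \<in> U"
      unfolding W_def by auto
    have "x s \<in> U \<inter> x ` S"
      using U(2) that by simp
    then show ?thesis
      using U(1) by (rule bexI)
  qed
  define C where "C Y = S - {s \<in> S. x s \<in> Y}" for Y
  have "S \<in> D"
    using D by (simp add: ultrafilter_over_def)
  then have "S \<noteq> {}"
    by (rule ultrafilter_over_nonempty[OF D])
  then have "\<Z> \<noteq> {}"
    using covered by fast
  have "C ` \<Z> \<subseteq> D"
    using \<Z>(1) by (auto simp: C_def \<Y>_def ultrafilter_over_Diff_iff[OF D])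
  moreover have "|C ` \<Z>| <o \<mu>"
    using card_of_image \<Z>(2) by (rule ordLeq_ordLess_trans)
  ultimately have "\<Inter>(C ` \<Z>) \<in> D"
    using complete \<open>\<Z> \<noteq> {}\<close> unfolding complete_ultrafilter_def by blast
  moreover have "\<Inter>(C ` \<Z>) = {}"
  proof (rule equals0I)
    fix s assume s: "s \<in> \<Inter>(C ` \<Z>)"
    then have "s \<in> S"
      using \<open>\<Z> \<noteq> {}\<close> unfolding C_def by blast
    then obtain Y where "Y \<in> \<Z>" "x s \<in> Y"
      by (rule covered[THEN bexE])
    then show False
      using s \<open>s \<in> S\<close> unfolding C_def by blast
  qed
  ultimately show False
    using ultrafilter_over_nonempty[OF D] by blast
qed

lemma product_subcover_below_strong_limit:
  assumes \<mu>: "Card_order \<mu>" and \<Lambda>: "strong_limit \<Lambda>"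
    and D: "ultrafilter_over S D" "complete_ultrafilter \<mu> D" "regular_ultrafilter \<mu> \<Lambda> D"
    and X: "\<And>j. j \<in> J \<Longrightarrow> interval_compact \<mu> \<Lambda> (X j)"
    and \<U>: "\<And>U. U \<in> \<U> \<Longrightarrow> openin (product_topology X J) U"
      "\<Union>\<U> = topspace (product_topology X J)" "|\<U>| <o \<Lambda>"
  shows "\<exists>\<V>. \<V> \<subseteq> \<U> \<and> \<Union>\<V> = topspace (product_topology X J) \<and> |\<V>| <o \<mu>"
proof (rule ccontr)
  assume none: "\<not> ?thesis"
  let ?P = "product_topology X J"
  have "\<forall>\<V>. \<exists>p. \<V> \<subseteq> \<U> \<and> |\<V>| <o \<mu> \<longrightarrow> p \<in> topspace ?P \<and> p \<notin> \<Union>\<V>"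
  proof
    fix \<V>
    have "\<exists>p. p \<in> topspace ?P \<and> p \<notin> \<Union>\<V>" if "\<V> \<subseteq> \<U>" "|\<V>| <o \<mu>"
    proof -
      have "\<Union>\<V> \<noteq> topspace ?P"
        using none that by blast
      moreover have "\<Union>\<V> \<subseteq> topspace ?P"
        using that(1) \<U>(2) by blast
      ultimately show ?thesis
        by blast
    qed
    then show "\<exists>p. \<V> \<subseteq> \<U> \<and> |\<V>| <o \<mu> \<longrightarrow> p \<in> topspace ?P \<and> p \<notin> \<Union>\<V>"
      by blast
  qed
  from choice[OF this] obtain p where
    p: "\<And>\<V>. \<V> \<subseteq> \<U> \<Longrightarrow> |\<V>| <o \<mu> \<Longrightarrow> p \<V> \<in> topspace ?P \<and> p \<V> \<notin> \<Union>\<V>"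
    by blast
  obtain \<F> where \<F>: "\<F> \<subseteq> D" "|\<F>| =o \<Lambda>" "\<And>\<G>. \<G> \<subseteq> \<F> \<Longrightarrow> |\<G>| =o \<mu> \<Longrightarrow> \<Inter>\<G> = {}"
    using D(3) unfolding regular_ultrafilter_def by blast
  have "|\<U>| \<le>o |\<F>|"
    using ordLess_imp_ordLeq[OF ordLess_ordIso_trans[OF \<U>(3) ordIso_symmetric[OF \<F>(2)]]] .
  then obtain h where h: "inj_on h \<U>" "h ` \<U> \<subseteq> \<F>"
    unfolding card_of_ordLeq[symmetric] by blast
  \<comment> \<open>By regularity no \<open>t\<close> lies in as many as \<open>\<mu>\<close> of the sets \<open>h U\<close>.\<close>
  define g where "g t = {U \<in> \<U>. t \<in> h U}" for t
  have g: "|g t| <o \<mu>" for t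
  proof (rule ccontr)
    assume "\<not> |g t| <o \<mu>"
    then have "\<mu> \<le>o |g t|"
      using \<mu> card_of_Well_order not_ordLess_iff_ordLeq unfolding card_order_on_def by blast
    then obtain B where B: "B \<subseteq> g t" "|B| =o \<mu>"
      using ordLeq_imp_subset_ordIso[OF \<mu>] by blast
    have "B \<subseteq> \<U>"
      using B(1) by (auto simp: g_def)
    then have "|B| =o |h ` B|"
      using inj_on_subset[OF h(1)] by (intro card_of_ordIsoI[OF inj_on_imp_bij_betw])
    then have "|h ` B| =o \<mu>"
      using ordIso_transitive[OF ordIso_symmetric B(2)] by blast
    moreover have "h ` B \<subseteq> \<F>"
      using h(2) \<open>B \<subseteq> \<U>\<close> by blast
    ultimately have "\<Inter>(h ` B) = {}"
      using \<F>(3) by blast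
    moreover have "t \<in> \<Inter>(h ` B)"
      using B(1) by (auto simp: g_def)
    ultimately show False
      by blast
  qed
  have g_le: "g t \<subseteq> \<U>" for t
    by (auto simp: g_def)
  define x where "x t = p (g t)" for t
  have x: "x t \<in> topspace ?P" "x t \<notin> \<Union>(g t)" for t
    using p[OF g_le g] by (simp_all add: x_def)
  have "\<exists>l. limitin (X j) (\<lambda>t. x t j) l (along S D)" if j: "j \<in> J" for j
  proof (rule complete_ultrafilter_limit[OF D(1,2) X[OF j]])
    show "(\<lambda>t. x t j) ` S \<subseteq> topspace (X j)"
      using x(1) j by (auto simp: PiE_iff)
    \<comment> \<open>\<open>x\<close> factors through \<open>Pow \<U>\<close>, however large \<open>S\<close> is.\<close>
    have "(\<lambda>t. x t j) ` S \<subseteq> (\<lambda>\<V>. p \<V> j) ` Pow \<U>"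
      using g_le by (auto simp: x_def)
    then have "|(\<lambda>t. x t j) ` S| \<le>o |Pow \<U>|"
      by (rule surj_imp_ordLeq)
    then have "|(\<lambda>t. x t j) ` S| <o \<Lambda>"
      using strong_limit_Pow[OF \<Lambda> \<U>(3)] by (rule ordLeq_ordLess_trans)
    then show "|Pow ((\<lambda>t. x t j) ` S)| \<le>o \<Lambda>"
      by (intro ordLess_imp_ordLeq strong_limit_Pow[OF \<Lambda>])
  qed
  then have "\<forall>j\<in>J. \<exists>l. limitin (X j) (\<lambda>t. x t j) l (along S D)"
    by (rule ballI)
  from bchoice[OF this] obtain l where
    l: "\<forall>j\<in>J. limitin (X j) (\<lambda>t. x t j) (l j) (along S D)"
    by (rule exE)
  have lim: "limitin ?P x (restrict l J) (along S D)"
    unfolding limitin_componentwise using l x(1) by (simp del: topspace_product_topology)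
  then have "restrict l J \<in> topspace ?P"
    by (rule limitin_topspace)
  then obtain U where U: "U \<in> \<U>" "restrict l J \<in> U"
    unfolding \<U>(2)[symmetric] by blast
  then have "\<forall>\<^sub>F t in along S D. x t \<in> U"
    using lim \<U>(1) unfolding limitin_def by blast
  then have "{t \<in> S. x t \<in> U} \<in> D"
    by (simp add: eventually_along[OF D(1)])
  moreover have "h U \<in> D"
    using h(2) \<F>(1) U(1) by blast
  ultimately have "{t \<in> S. x t \<in> U} \<inter> h U \<noteq> {}"
    using ultrafilter_over_nonempty[OF D(1)] ultrafilter_over_Int[OF D(1)] by blast
  then show False
    using x(2) U(1) unfolding g_def by blast
qed

text \<open>
  The assumptions on \<open>K\<close> say that \<open>|K|\<close> is the cofinality of \<open>\<Lambda>\<close> and that \<open>\<Lambda>\<close> is singular.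
\<close>

lemma interval_compact_if_smaller_subcovers:
  assumes \<mu>: "\<mu> \<le>o |K|" and \<Lambda>: "Cinfinite \<Lambda>"
    and K: "K \<subseteq> Field \<Lambda>" "cofinal K \<Lambda>" "|K| <o \<Lambda>"
      "\<And>L. L \<subseteq> Field \<Lambda> \<Longrightarrow> cofinal L \<Lambda> \<Longrightarrow> |K| \<le>o |L|"
    and smaller: "\<And>\<U>. (\<And>U. U \<in> \<U> \<Longrightarrow> openin X U) \<Longrightarrow> \<Union>\<U> = topspace X \<Longrightarrow> |\<U>| <o \<Lambda> \<Longrightarrow>
      \<exists>\<V>. \<V> \<subseteq> \<U> \<and> \<Union>\<V> = topspace X \<and> |\<V>| <o \<mu>"
  shows "interval_compact \<mu> \<Lambda> X"
  unfolding interval_compact_def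
proof (intro allI impI, elim conjE)
  fix \<U> assume open_\<U>: "\<forall>U\<in>\<U>. openin X U" and cover: "\<Union>\<U> = topspace X" and card: "|\<U>| \<le>o \<Lambda>"
  have co: "Card_order \<Lambda>" and inf: "infinite (Field \<Lambda>)"
    using \<Lambda> by (simp_all add: cinfinite_def)
  have "|\<U>| \<le>o |Field \<Lambda>|"
    using ordLeq_ordIso_trans[OF card ordIso_symmetric[OF card_of_Field_ordIso[OF co]]] .
  then obtain e where e: "inj_on e \<U>" "e ` \<U> \<subseteq> Field \<Lambda>"
    unfolding card_of_ordLeq[symmetric] by blast
  have wo: "wo_rel \<Lambda>"
    using co by (simp add: wo_rel_def card_order_on_def)
  define V where "V a = {U \<in> \<U>. e U \<in> underS \<Lambda> a}" for a
  have V: "|V a| <o \<Lambda>" if "a \<in> Field \<Lambda>" for a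
  proof -
    have "|V a| \<le>o |underS \<Lambda> a|"
      by (rule card_of_ordLeqI[of e]) (auto simp: V_def intro: inj_on_subset[OF e(1)])
    then show ?thesis
      using card_of_underS[OF co that] by (rule ordLeq_ordLess_trans)
  qed
  have V_le: "V a \<subseteq> \<U>" for a
    by (auto simp: V_def)
  have V_mono: "V a \<subseteq> V b" if "(a, b) \<in> \<Lambda>" for a b
    using that wo_rel.TRANS[OF wo] wo_rel.ANTISYM[OF wo]
    by (auto simp: V_def underS_def trans_def antisym_def)
  have V_cofinal: "topspace X \<subseteq> \<Union>((\<lambda>k. \<Union>(V k)) ` K)"
  proof
    fix y assume "y \<in> topspace X"
    then obtain U where U: "U \<in> \<U>" "y \<in> U"
      using cover by blast
    then obtain k where "k \<in> K" "e U \<noteq> k" "(e U, k) \<in> \<Lambda>"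
      using K(2) e(2) unfolding cofinal_def by blast
    then have "U \<in> V k"
      using U(1) by (simp add: V_def underS_def)
    then show "y \<in> \<Union>((\<lambda>k. \<Union>(V k)) ` K)"
      using U(2) \<open>k \<in> K\<close> by blast
  qed
  define \<W> where "\<W> = (\<lambda>k. \<Union>(V k)) ` K"
  have "|\<W>| <o \<Lambda>"
    unfolding \<W>_def using card_of_image K(3) by (rule ordLeq_ordLess_trans)
  moreover have "openin X W" if "W \<in> \<W>" for W
    using that V_le open_\<U> unfolding \<W>_def by (blast intro: openin_Union)
  moreover have "\<Union>\<W> = topspace X"
    using V_cofinal V_le cover unfolding \<W>_def by blast
  ultimately have "\<exists>\<V>. \<V> \<subseteq> \<W> \<and> \<Union>\<V> = topspace X \<and> |\<V>| <o \<mu>"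
    by (intro smaller)
  then obtain \<V> where \<V>: "\<V> \<subseteq> \<W>" "\<Union>\<V> = topspace X" "|\<V>| <o \<mu>"
    by blast
  obtain L where L: "L \<subseteq> K" "inj_on (\<lambda>k. \<Union>(V k)) L" "\<V> = (\<lambda>k. \<Union>(V k)) ` L"
    using \<V>(1) unfolding \<W>_def subset_image_inj by blast
  have "|L| =o |\<V>|"
    unfolding L(3) using L(2) by (rule card_of_ordIsoI[OF inj_on_imp_bij_betw])
  then have "|L| <o |K|"
    using ordLess_ordLeq_trans[OF ordIso_ordLess_trans[OF _ \<V>(3)] \<mu>] by blast
  \<comment> \<open>So \<open>L\<close> has an upper bound \<open>a\<close>, and the single family \<open>V a\<close> covers the space.\<close>
  then have "\<not> cofinal L \<Lambda>"
    using K(1,4) L(1) not_ordLess_ordLeq by blast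
  then obtain a where a: "a \<in> Field \<Lambda>" "\<And>b. b \<in> L \<Longrightarrow> a = b \<or> (a, b) \<notin> \<Lambda>"
    unfolding cofinal_def by blast
  have "(b, a) \<in> \<Lambda>" if "b \<in> L" for b
    using a that L(1) K(1) wo_rel.TOTALS[OF wo] by blast
  then have "\<Union>\<V> \<subseteq> \<Union>(V a)"
    using V_mono unfolding L(3) by blast
  then have "\<Union>(V a) = topspace X"
    using \<V>(2) V_le cover by blast
  moreover have "openin X U" if "U \<in> V a" for U
    using that V_le open_\<U> by blast
  ultimately have "\<exists>\<V>. \<V> \<subseteq> V a \<and> \<Union>\<V> = topspace X \<and> |\<V>| <o \<mu>"
    using V[OF a(1)] by (intro smaller)
  then obtain \<V>' where "\<V>' \<subseteq> V a" "\<Union>\<V>' = topspace X" "|\<V>'| <o \<mu>"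
    by blast
  moreover have "\<V>' \<subseteq> \<U>"
    using calculation(1) V_le by (rule subset_trans)
  ultimately show "\<exists>\<V>. \<V> \<subseteq> \<U> \<and> \<Union>\<V> = topspace X \<and> |\<V>| <o \<mu>"
    by (intro exI[of _ \<V>'] conjI)
qed

theorem compact_cardinal_imp_productive:
  fixes \<mu> :: "'m rel" and \<Lambda> :: "'l rel"
  assumes "compact_cardinal TYPE('s) \<mu> \<Lambda>" and \<Lambda>: "strong_limit \<Lambda>" "singular \<Lambda>"
    and \<mu>: "\<mu> \<le>o cofinality \<Lambda>"
  shows "productive TYPE('i) TYPE('a) \<mu> \<Lambda>"
  unfolding productive_def productive_for_def
proof (intro allI impI)
  fix J :: "'i set" and X :: "'i \<Rightarrow> 'a topology"
  assume X: "\<forall>j\<in>J. X j \<in> UNIV \<and> interval_compact \<mu> \<Lambda> (X j)"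
  obtain S :: "'s set" and D where "Card_order \<mu>"
    and D: "ultrafilter_over S D" "complete_ultrafilter \<mu> D" "regular_ultrafilter \<mu> \<Lambda> D"
    using assms(1) unfolding compact_cardinal_def by blast
  have Cinf: "Cinfinite \<Lambda>"
    using \<Lambda>(1) by (simp add: strong_limit_def)
  obtain K where K: "K \<subseteq> Field \<Lambda>" "cofinal K \<Lambda>" "cofinality \<Lambda> = |K|"
    "\<And>L. L \<subseteq> Field \<Lambda> \<Longrightarrow> cofinal L \<Lambda> \<Longrightarrow> |K| \<le>o |L|"
    using cofinality_attained[OF Cinf] by blast
  obtain L where L: "L \<subseteq> Field \<Lambda>" "cofinal L \<Lambda>" "\<not> |L| =o \<Lambda>"
    using \<Lambda>(2) unfolding singular_def regularCard_def by blast
  have "|L| \<le>o \<Lambda>"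
    using card_of_mono1[OF L(1)] card_of_Field_ordIso[OF conjunct2[OF Cinf]]
    by (rule ordLeq_ordIso_trans)
  then have "|L| <o \<Lambda>"
    using L(3) ordLeq_iff_ordLess_or_ordIso by blast
  with K(4)[OF L(1,2)] have "|K| <o \<Lambda>"
    by (rule ordLeq_ordLess_trans)
  have "\<mu> \<le>o |K|"
    using \<mu> K(3) by simp
  then show "interval_compact \<mu> \<Lambda> (product_topology X J)"
    using Cinf K(1,2) \<open>|K| <o \<Lambda>\<close> K(4)
  proof (rule interval_compact_if_smaller_subcovers)
    have X': "interval_compact \<mu> \<Lambda> (X j)" if "j \<in> J" for j
      using X that by simp
    fix \<U> assume "\<And>U. U \<in> \<U> \<Longrightarrow> openin (product_topology X J) U"
      "\<Union>\<U> = topspace (product_topology X J)" "|\<U>| <o \<Lambda>"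
    with X' show "\<exists>\<V>. \<V> \<subseteq> \<U> \<and> \<Union>\<V> = topspace (product_topology X J) \<and> |\<V>| <o \<mu>"
      by (rule product_subcover_below_strong_limit[OF \<open>Card_order \<mu>\<close> \<Lambda>(1) D])
  qed
qed

theorem theorem1:
  fixes \<mu> :: "'m rel" and \<Lambda> :: "'l rel"
  assumes "Card_order \<mu>" and "Card_order \<Lambda>" and "natLeq <o \<mu>" and "\<mu> \<le>o \<Lambda>"
  shows "((productive_for TYPE('l set set set) \<mu> \<Lambda> (regular_below \<mu>) \<longrightarrow>
            compact_cardinal TYPE('l set) \<mu> \<Lambda>) \<and>
          (productive TYPE('l set set set) TYPE('m) \<mu> \<Lambda> \<longrightarrow>
            compact_cardinal TYPE('l set) \<mu> \<Lambda>)) \<and>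
         (compact_cardinal TYPE('s) \<mu> \<Lambda> \<and> strong_limit \<Lambda> \<and> singular \<Lambda> \<and>
            \<mu> \<le>o cofinality \<Lambda> \<longrightarrow>
            productive TYPE('i) TYPE('a) \<mu> \<Lambda>)"
proof (intro conjI impI)
  show "compact_cardinal TYPE('l set) \<mu> \<Lambda>"
    if "productive_for TYPE('l set set set) \<mu> \<Lambda> (regular_below \<mu>)"
    using assms that by (rule productive_for_regular_below_imp_compact_cardinal)
  show "compact_cardinal TYPE('l set) \<mu> \<Lambda>"
    if "productive TYPE('l set set set) TYPE('m) \<mu> \<Lambda>"
  proof (rule productive_for_regular_below_imp_compact_cardinal[OF assms])
    show "productive_for TYPE('l set set set) \<mu> \<Lambda> (regular_below \<mu>)"
      using that unfolding productive_def productive_for_def by simp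
  qed
  show "productive TYPE('i) TYPE('a) \<mu> \<Lambda>"
    if "compact_cardinal TYPE('s) \<mu> \<Lambda> \<and> strong_limit \<Lambda> \<and> singular \<Lambda> \<and> \<mu> \<le>o cofinality \<Lambda>"
    using that by (intro compact_cardinal_imp_productive[where 's = 's]) simp_all
qed

end
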